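(* Let $M$ be a smooth manifold, $f\in C^\infty(M)$ and $\theta$ a closed $1$-form on $M$. If the function $f$ does not vanish (at any point of $M$), then $H^{\bullet}_{f,\theta}(M)$ is isomorphic to the Lichnerowicz cohomology $H^{\bullet}_{\theta}(M)$.
   Context: $\Omega^r(M)$ is the space of smooth real $r$-forms on $M$. For a closed $1$-form $\theta$, the operator $d_\theta\varphi=d\varphi-\theta\wedge\varphi$ satisfies $d_\theta^2=0$, and the Lichnerowicz cohomology $H^\bullet_\theta(M)$ is the cohomology of $(\Omega^\bullet(M),d_\theta)$. For $f\in C^\infty(M)$ and $\varphi\in\Omega^r(M)$ put $d_f\varphi=f\,d\varphi-r\,df\wedge\varphi$ and $d_{f,\theta}\varphi=d_f\varphi-f\theta\wedge\varphi$. Then $d_{f,\theta}^2=0$, and $H^\bullet_{f,\theta}(M)$ is the cohomology of $(\Omega^\bullet(M),d_{f,\theta})$. *)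

theory Defs
  imports "HOL-Analysis.Analysis" "HOL-Library.Function_Algebras"
begin

section \<open>Smooth maps on open subsets of a finite-dimensional space\<close>

text \<open>Both notions are meant for an open set \<open>S\<close> in a finite-dimensional normed space, where
  being of class \<open>C\<^sup>k\<^sup>+\<^sup>1\<close> amounts to differentiability with directional derivatives of class \<open>C\<^sup>k\<close>.\<close>

primrec Ck_on :: "nat \<Rightarrow> 'e::real_normed_vector set \<Rightarrow> ('e \<Rightarrow> 'b::real_normed_vector) \<Rightarrow> bool" where
  "Ck_on 0 S g \<longleftrightarrow> continuous_on S g"
| "Ck_on (Suc k) S g \<longleftrightarrow> (\<forall>x\<in>S. g differentiable (at x)) \<and>
     (\<forall>v. Ck_on k S (\<lambda>x. frechet_derivative g (at x) v))"

definition smooth_on :: "'e::real_normed_vector set \<Rightarrow> ('e \<Rightarrow> 'b::real_normed_vector) \<Rightarrow> bool" where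
  "smooth_on S g \<longleftrightarrow> (\<forall>k. Ck_on k S g)"


section \<open>Smooth manifolds\<close>

text \<open>A chart is a domain together with a coordinate map, whose values off the domain are
  irrelevant.\<close>

type_synonym ('a, 'e) chart = "'a set \<times> ('a \<Rightarrow> 'e)"

definition chart_image :: "('a, 'e) chart \<Rightarrow> 'e set" where
  "chart_image c = snd c ` fst c"

definition chart_inv :: "('a, 'e) chart \<Rightarrow> 'e \<Rightarrow> 'a" where
  "chart_inv c = inv_into (fst c) (snd c)"

definition transition :: "('a, 'e) chart \<Rightarrow> ('a, 'e) chart \<Rightarrow> 'e \<Rightarrow> 'e" where
  "transition c c' = snd c' \<circ> chart_inv c"

definition overlap :: "('a, 'e) chart \<Rightarrow> ('a, 'e) chart \<Rightarrow> 'e set" where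
  "overlap c c' = snd c ` (fst c \<inter> fst c')"

text \<open>The model space \<open>'e\<close> is an arbitrary finite-dimensional normed space rather than one of class
  \<open>euclidean_space\<close>, since the latter would exclude dimension 0. The atlas need not be maximal.\<close>

locale smooth_manifold =
  fixes X :: "'a topology" and A :: "('a, 'e::real_normed_vector) chart set"
  assumes Hausdorff: "Hausdorff_space X"
    and second_countable: "second_countable X"
    and finite_dimensional: "\<exists>B::'e set. finite B \<and> span B = UNIV"
    and chart_domain: "c \<in> A \<Longrightarrow> openin X (fst c)"
    and chart_image_open: "c \<in> A \<Longrightarrow> open (chart_image c)"
    and chart_homeomorphic: "c \<in> A \<Longrightarrow>
      homeomorphic_map (subtopology X (fst c)) (top_of_set (chart_image c)) (snd c)"
    and charts_cover: "(\<Union>c\<in>A. fst c) = topspace X"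
    and charts_compatible: "c \<in> A \<Longrightarrow> c' \<in> A \<Longrightarrow> smooth_on (overlap c c') (transition c c')"

definition smooth_function ::
  "('a, 'e::real_normed_vector) chart set \<Rightarrow> ('a \<Rightarrow> real) \<Rightarrow> bool" where
  "smooth_function A f \<longleftrightarrow> (\<forall>c\<in>A. smooth_on (chart_image c) (f \<circ> chart_inv c))"


section \<open>Differential forms\<close>

text \<open>An alternating \<open>r\<close>-linear form takes its arguments as a sequence, of which only the entries
  with index below \<open>r\<close> matter.\<close>

definition alternating_forms :: "nat \<Rightarrow> ((nat \<Rightarrow> 'e::real_vector) \<Rightarrow> real) set" where
  "alternating_forms r = {a.
     (\<forall>v w. (\<forall>i<r. v i = w i) \<longrightarrow> a v = a w) \<and>
     (\<forall>v. \<forall>i<r. linear (\<lambda>u. a (v(i := u)))) \<and>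
     (\<forall>v i j. i < r \<longrightarrow> j < r \<longrightarrow> i \<noteq> j \<longrightarrow> v i = v j \<longrightarrow> a v = 0)}"

text \<open>A form on a manifold is given by its coordinate representations \<open>\<omega> c\<close> on the images of the
  charts \<open>c\<close> of the atlas, subject to \<open>\<omega> c = (transition c c')\<^sup>* (\<omega> c')\<close> on overlaps (this is the
  definition in Bott and Tu, Differential Forms in Algebraic Topology, Section I.2). In order
  that equal forms are equal functions, representations are extended by 0.\<close>

type_synonym ('a, 'e) form = "('a, 'e) chart \<Rightarrow> 'e \<Rightarrow> (nat \<Rightarrow> 'e) \<Rightarrow> real"

definition forms ::
  "('a, 'e::real_normed_vector) chart set \<Rightarrow> nat \<Rightarrow> ('a, 'e) form set" where
  "forms A r = {\<omega>.
     (\<forall>c x v. c \<notin> A \<or> x \<notin> chart_image c \<longrightarrow> \<omega> c x v = 0) \<and>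
     (\<forall>c\<in>A. \<forall>x\<in>chart_image c. \<omega> c x \<in> alternating_forms r) \<and>
     (\<forall>c\<in>A. \<forall>v. smooth_on (chart_image c) (\<lambda>x. \<omega> c x v)) \<and>
     (\<forall>c\<in>A. \<forall>c'\<in>A. \<forall>x\<in>overlap c c'. \<forall>v.
        \<omega> c x v = \<omega> c' (transition c c' x)
                     (\<lambda>i. frechet_derivative (transition c c') (at x) (v i)))}"

definition function_form ::
  "('a, 'e) chart set \<Rightarrow> ('a \<Rightarrow> real) \<Rightarrow> ('a, 'e) form" where
  "function_form A f c x v = (if c \<in> A \<and> x \<in> chart_image c then f (chart_inv c x) else 0)"

definition mult_form :: "('a \<Rightarrow> real) \<Rightarrow> ('a, 'e) form \<Rightarrow> ('a, 'e) form" where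
  "mult_form f \<omega> c x v = f (chart_inv c x) * \<omega> c x v"

definition omit :: "nat \<Rightarrow> (nat \<Rightarrow> 'e) \<Rightarrow> nat \<Rightarrow> 'e" where
  "omit i v j = (if j < i then v j else v (Suc j))"

text \<open>The exterior derivative of an \<open>r\<close>-form:
  \<open>d\<omega>(v\<^sub>0,\<dots>,v\<^sub>r) = \<Sum>\<^sub>i (-1)\<^sup>i D\<^bsub>v\<^sub>i\<^esub>\<omega>(v\<^sub>0,\<dots>,v\<^sub>i\<^sub>-\<^sub>1,v\<^sub>i\<^sub>+\<^sub>1,\<dots>,v\<^sub>r)\<close> for constant \<open>v\<^sub>0,\<dots>,v\<^sub>r\<close>.\<close>

definition ext_deriv ::
  "('a, 'e::real_normed_vector) chart set \<Rightarrow> nat \<Rightarrow> ('a, 'e) form \<Rightarrow> ('a, 'e) form" where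
  "ext_deriv A r \<omega> c x v = (if c \<in> A \<and> x \<in> chart_image c then
     (\<Sum>i\<le>r. (-1) ^ i * frechet_derivative (\<lambda>y. \<omega> c y (omit i v)) (at x) (v i)) else 0)"

text \<open>The wedge product of a \<open>1\<close>-form with an \<open>r\<close>-form, i.e. the sum over \<open>(1,r)\<close>-shuffles. The
  normalization is the one for which \<open>d(f\<omega>) = df \<and> \<omega> + f d\<omega>\<close>.\<close>

definition wedge1 :: "nat \<Rightarrow> ('a, 'e) form \<Rightarrow> ('a, 'e) form \<Rightarrow> ('a, 'e) form" where
  "wedge1 r \<theta> \<omega> c x v = (\<Sum>i\<le>r. (-1) ^ i * \<theta> c x (\<lambda>_. v i) * \<omega> c x (omit i v))"

definition closed_1_form ::
  "('a, 'e::real_normed_vector) chart set \<Rightarrow> ('a, 'e) form \<Rightarrow> bool" where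
  "closed_1_form A \<theta> \<longleftrightarrow> \<theta> \<in> forms A 1 \<and> ext_deriv A 1 \<theta> = 0"


section \<open>Cohomology\<close>

instantiation "fun" :: (type, real_vector) real_vector
begin

definition "c *\<^sub>R g = (\<lambda>x. c *\<^sub>R g x)"

instance
  by standard (auto simp: scaleR_fun_def plus_fun_def algebra_simps)

end

record 'v real_space =
  rs_carrier :: "'v set"
  rs_add :: "'v \<Rightarrow> 'v \<Rightarrow> 'v"
  rs_scale :: "real \<Rightarrow> 'v \<Rightarrow> 'v"

definition real_space_isomorphic :: "'v real_space \<Rightarrow> 'w real_space \<Rightarrow> bool" where
  "real_space_isomorphic V W \<longleftrightarrow> (\<exists>T. bij_betw T (rs_carrier V) (rs_carrier W) \<and>
     (\<forall>x\<in>rs_carrier V. \<forall>y\<in>rs_carrier V. T (rs_add V x y) = rs_add W (T x) (T y)) \<and>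
     (\<forall>a. \<forall>x\<in>rs_carrier V. T (rs_scale V a x) = rs_scale W a (T x)))"

text \<open>The quotient of a subspace \<open>Z\<close> by a subspace \<open>B \<subseteq> Z\<close>. In \<open>rs_scale\<close> the summand \<open>B\<close> only
  matters for \<open>a = 0\<close>, where \<open>(*\<^sub>R) a ` K\<close> is \<open>{0}\<close> and not a coset.\<close>

definition quotient_space :: "'v::real_vector set \<Rightarrow> 'v set \<Rightarrow> 'v set real_space" where
  "quotient_space Z B =
     \<lparr>rs_carrier = (\<lambda>z. z +o B) ` Z, rs_add = (\<lambda>K L. K + L), rs_scale = (\<lambda>a K. (*\<^sub>R) a ` K + B)\<rparr>"

definition cocycles ::
  "(nat \<Rightarrow> 'v::real_vector set) \<Rightarrow> (nat \<Rightarrow> 'v \<Rightarrow> 'v) \<Rightarrow> nat \<Rightarrow> 'v set" where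
  "cocycles C D r = {\<omega> \<in> C r. D r \<omega> = 0}"

fun coboundaries ::
  "(nat \<Rightarrow> 'v::real_vector set) \<Rightarrow> (nat \<Rightarrow> 'v \<Rightarrow> 'v) \<Rightarrow> nat \<Rightarrow> 'v set" where
  "coboundaries C D 0 = {0}"
| "coboundaries C D (Suc r) = D r ` C r"

definition cohomology ::
  "(nat \<Rightarrow> 'v::real_vector set) \<Rightarrow> (nat \<Rightarrow> 'v \<Rightarrow> 'v) \<Rightarrow> nat \<Rightarrow> 'v set real_space" where
  "cohomology C D r = quotient_space (cocycles C D r) (coboundaries C D r)"

definition d_theta ::
  "('a, 'e::real_normed_vector) chart set \<Rightarrow> ('a, 'e) form \<Rightarrow> nat \<Rightarrow> ('a, 'e) form \<Rightarrow> ('a, 'e) form"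
  where "d_theta A \<theta> r \<phi> = ext_deriv A r \<phi> - wedge1 r \<theta> \<phi>"

definition d_f ::
  "('a, 'e::real_normed_vector) chart set \<Rightarrow> ('a \<Rightarrow> real) \<Rightarrow> nat \<Rightarrow> ('a, 'e) form \<Rightarrow> ('a, 'e) form"
  where "d_f A f r \<phi> = mult_form f (ext_deriv A r \<phi>) -
    real r *\<^sub>R wedge1 r (ext_deriv A 0 (function_form A f)) \<phi>"

definition d_f_theta ::
  "('a, 'e::real_normed_vector) chart set \<Rightarrow> ('a \<Rightarrow> real) \<Rightarrow> ('a, 'e) form \<Rightarrow>
   nat \<Rightarrow> ('a, 'e) form \<Rightarrow> ('a, 'e) form"
  where "d_f_theta A f \<theta> r \<phi> = d_f A f r \<phi> - wedge1 r (mult_form f \<theta>) \<phi>"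

definition lichnerowicz_cohomology ::
  "('a, 'e::real_normed_vector) chart set \<Rightarrow> ('a, 'e) form \<Rightarrow> nat \<Rightarrow> ('a, 'e) form set real_space"
  where "lichnerowicz_cohomology A \<theta> r = cohomology (forms A) (d_theta A \<theta>) r"

definition f_theta_cohomology ::
  "('a, 'e::real_normed_vector) chart set \<Rightarrow> ('a \<Rightarrow> real) \<Rightarrow> ('a, 'e) form \<Rightarrow>
   nat \<Rightarrow> ('a, 'e) form set real_space"
  where "f_theta_cohomology A f \<theta> r = cohomology (forms A) (d_f_theta A f \<theta>) r"

end

theory Submission
  imports Defs
begin

text \<open>Multiplication by \<open>f\<^sup>-\<^sup>r\<close> on \<open>r\<close>-forms is a bijection of \<open>\<Omega>\<^sup>r(M)\<close>, and the Leibniz rule gives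
  \<open>d\<^sub>\<theta> (f\<^sup>-\<^sup>r \<phi>) = f\<^sup>-\<^sup>r d\<phi> - r f\<^sup>-\<^sup>r\<^sup>-\<^sup>1 df \<and> \<phi> - f\<^sup>-\<^sup>r \<theta> \<and> \<phi> = f\<^sup>-\<^sup>r\<^sup>-\<^sup>1 d\<^bsub>f,\<theta>\<^esub> \<phi>\<close>. So these bijections form an
  isomorphism of complexes.\<close>

section \<open>Smooth real functions\<close>

lemma frechet_derivative_cong_open:
  assumes "open S" "x \<in> S" "g differentiable (at x)" "\<And>y. y \<in> S \<Longrightarrow> g y = h y"
  shows "frechet_derivative h (at x) = frechet_derivative g (at x)"
proof -
  have "(g has_derivative frechet_derivative g (at x)) (at x)"
    using assms(3) frechet_derivative_works by blast
  then have D: "(h has_derivative frechet_derivative g (at x)) (at x)"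
    by (rule has_derivative_transform_within_open) (use assms in auto)
  show ?thesis
    unfolding frechet_derivative_at[OF D, symmetric] ..
qed

text \<open>On an open set, agreement of two functions passes to their derivatives, so the induction
  runs over all pairs \<open>g\<close>, \<open>h\<close>. This lets derivative formulas valid only
  on \<open>S\<close> be substituted below.\<close>

lemma Ck_on_cong_imp:
  assumes "open S" "\<And>x. x \<in> S \<Longrightarrow> g x = h x" "Ck_on k S g"
  shows "Ck_on k S h"
  using assms(2,3)
proof (induction k arbitrary: g h)
  case 0
  then show ?case
    using continuous_on_cong by fastforce
next
  case (Suc k)
  have d: "g differentiable (at x)" if "x \<in> S" for x
    using Suc.prems(2) that by simp
  have "h differentiable (at x)" if x: "x \<in> S" for x
  proof -
    obtain D where "(g has_derivative D) (at x)"
      using d[OF x] unfolding differentiable_def by blast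
    then have "(h has_derivative D) (at x)"
      by (rule has_derivative_transform_within_open) (use assms(1) x Suc.prems(1) in auto)
    then show ?thesis
      unfolding differentiable_def by blast
  qed
  moreover have D: "frechet_derivative h (at x) = frechet_derivative g (at x)" if "x \<in> S" for x
    using frechet_derivative_cong_open[OF assms(1) that d[OF that]] Suc.prems(1) by blast
  moreover have "Ck_on k S (\<lambda>x. frechet_derivative h (at x) v)" for v
    by (rule Suc.IH[of "\<lambda>x. frechet_derivative g (at x) v"]) (use Suc.prems(2) D in auto)
  ultimately show ?case
    by simp
qed

text \<open>Differentiability gives continuity at the bottom; above it the claim is inherited by the
  directional derivatives. It serves the undifferentiated factors in the product and reciprocal
  rules.\<close>

lemma Ck_on_Suc_imp: "Ck_on (Suc k) S g \<Longrightarrow> Ck_on k S g"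
proof (induction k arbitrary: g)
  case 0
  then show ?case
    by (auto intro!: differentiable_imp_continuous_on
        simp: differentiable_on_def differentiable_at_withinI)
next
  case (Suc k)
  then show ?case
    unfolding Ck_on.simps(2)[of "Suc k"] Ck_on.simps(2)[of k S g] by blast
qed

lemma Ck_on_const: "Ck_on k S (\<lambda>x. c)"
  by (induction k arbitrary: c) auto

section \<open>Derivative rules and closure properties of C^k functions\<close>

lemma frechet_derivative_add_at:
  assumes "g differentiable (at x)" "h differentiable (at x)"
  shows "frechet_derivative (\<lambda>x. g x + h x) (at x) v =
    frechet_derivative g (at x) v + frechet_derivative h (at x) v"
proof -
  have D: "((\<lambda>x. g x + h x) has_derivative (\<lambda>v. frechet_derivative g (at x) v +
      frechet_derivative h (at x) v)) (at x)"
    using assms by (intro has_derivative_add) (auto simp: frechet_derivative_works)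
  show ?thesis
    unfolding frechet_derivative_at[OF D, symmetric] ..
qed

lemma Ck_on_add:
  assumes "open S" "Ck_on k S g" "Ck_on k S h"
  shows "Ck_on k S (\<lambda>x. g x + h x)"
  using assms(2,3)
proof (induction k arbitrary: g h)
  case 0
  then show ?case by (auto intro: continuous_on_add)
next
  case (Suc k)
  have d: "g differentiable (at x)" "h differentiable (at x)" if "x \<in> S" for x
    using Suc.prems that by auto
  have "Ck_on k S (\<lambda>x. frechet_derivative g (at x) v + frechet_derivative h (at x) v)" for v
    using Suc.prems by (intro Suc.IH) auto
  then have "Ck_on k S (\<lambda>x. frechet_derivative (\<lambda>x. g x + h x) (at x) v)" for v
    by (rule Ck_on_cong_imp[OF assms(1), rotated]) (simp add: frechet_derivative_add_at d)
  then show ?case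
    using d by auto
qed

lemma frechet_derivative_mult_at:
  fixes g h :: "'e::real_normed_vector \<Rightarrow> real"
  assumes "g differentiable (at x)" "h differentiable (at x)"
  shows "frechet_derivative (\<lambda>x. g x * h x) (at x) v =
    g x * frechet_derivative h (at x) v + frechet_derivative g (at x) v * h x"
proof -
  have D: "((\<lambda>x. g x * h x) has_derivative (\<lambda>v. g x * frechet_derivative h (at x) v +
      frechet_derivative g (at x) v * h x)) (at x)"
    using assms by (intro has_derivative_mult) (auto simp: frechet_derivative_works)
  show ?thesis
    unfolding frechet_derivative_at[OF D, symmetric] ..
qed

lemma frechet_derivative_inverse_at:
  fixes g :: "'e::real_normed_vector \<Rightarrow> real"
  assumes "g differentiable (at x)" "g x \<noteq> 0"
  shows "frechet_derivative (\<lambda>x. inverse (g x)) (at x) v =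
    - (frechet_derivative g (at x) v * (inverse (g x) * inverse (g x)))"
proof -
  have D: "((\<lambda>x. inverse (g x)) has_derivative
      (\<lambda>v. - (inverse (g x) * frechet_derivative g (at x) v * inverse (g x)))) (at x)"
    using assms by (intro Deriv.has_derivative_inverse) (auto simp: frechet_derivative_works)
  show ?thesis
    unfolding frechet_derivative_at[OF D, symmetric] by (simp add: mult_ac)
qed

lemma frechet_derivative_power_at:
  fixes g :: "'e::real_normed_vector \<Rightarrow> real"
  assumes "g differentiable (at x)"
  shows "frechet_derivative (\<lambda>x. g x ^ n) (at x) v =
    real n * g x ^ (n - 1) * frechet_derivative g (at x) v"
proof -
  have D: "((\<lambda>x. g x ^ n) has_derivative
      (\<lambda>v. of_nat n * frechet_derivative g (at x) v * g x ^ (n - 1))) (at x)"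
    using assms by (intro has_derivative_power) (auto simp: frechet_derivative_works)
  show ?thesis
    unfolding frechet_derivative_at[OF D, symmetric] by (simp add: mult_ac)
qed

text \<open>By the product rule the derivative is a sum of products of C^k functions, to which the
  induction hypothesis applies.\<close>

lemma Ck_on_mult:
  fixes g h :: "'e::real_normed_vector \<Rightarrow> real"
  assumes "open S" "Ck_on k S g" "Ck_on k S h"
  shows "Ck_on k S (\<lambda>x. g x * h x)"
  using assms(2,3)
proof (induction k arbitrary: g h)
  case 0
  then show ?case by (auto intro: continuous_on_mult)
next
  case (Suc k)
  have d: "g differentiable (at x)" "h differentiable (at x)" if "x \<in> S" for x
    using Suc.prems that by auto
  have g: "Ck_on k S g" and h: "Ck_on k S h"
    using Suc.prems Ck_on_Suc_imp by blast+
  have "Ck_on k S (\<lambda>x. g x * frechet_derivative h (at x) v + frechet_derivative g (at x) v * h x)"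
    for v
    using Suc.prems by (intro Ck_on_add[OF assms(1)] Suc.IH g h) auto
  then have "Ck_on k S (\<lambda>x. frechet_derivative (\<lambda>x. g x * h x) (at x) v)" for v
    by (rule Ck_on_cong_imp[OF assms(1), rotated]) (simp add: frechet_derivative_mult_at d)
  then show ?case
    using d by auto
qed

text \<open>The derivative of 1/g is -g'/g^2, a product of C^k functions once the induction
  hypothesis gives that 1/g is C^k.\<close>

lemma Ck_on_inverse:
  fixes g :: "'e::real_normed_vector \<Rightarrow> real"
  assumes "open S" "\<And>x. x \<in> S \<Longrightarrow> g x \<noteq> 0" "Ck_on k S g"
  shows "Ck_on k S (\<lambda>x. inverse (g x))"
  using assms(3)
proof (induction k)
  case 0
  then show ?case using assms(2) by (auto intro: continuous_on_inverse)
next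
  case (Suc k)
  have d: "g differentiable (at x)" if "x \<in> S" for x
    using Suc.prems that by auto
  have i: "Ck_on k S (\<lambda>x. inverse (g x))"
    using Suc Ck_on_Suc_imp by blast
  \<comment> \<open>The sign is written as a constant factor so that \<open>Ck_on_mult\<close>
    covers it.\<close>
  have "Ck_on k S (\<lambda>x. (-1) * (frechet_derivative g (at x) v * (inverse (g x) * inverse (g x))))"
    for v
    using Suc.prems by (intro Ck_on_mult[OF assms(1)] i Ck_on_const) auto
  then have "Ck_on k S (\<lambda>x. frechet_derivative (\<lambda>x. inverse (g x)) (at x) v)" for v
    by (rule Ck_on_cong_imp[OF assms(1), rotated])
      (simp add: frechet_derivative_inverse_at d assms(2))
  then show ?case
    using d assms(2) by auto
qed

lemma smooth_on_cong_imp: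
  "\<lbrakk>open S; \<And>x. x \<in> S \<Longrightarrow> g x = h x; smooth_on S g\<rbrakk> \<Longrightarrow> smooth_on S h"
  unfolding smooth_on_def using Ck_on_cong_imp by blast

lemma smooth_on_mult:
  fixes g h :: "'e::real_normed_vector \<Rightarrow> real"
  shows "\<lbrakk>open S; smooth_on S g; smooth_on S h\<rbrakk> \<Longrightarrow> smooth_on S (\<lambda>x. g x * h x)"
  unfolding smooth_on_def using Ck_on_mult by blast

lemma smooth_on_power:
  fixes g :: "'e::real_normed_vector \<Rightarrow> real"
  shows "\<lbrakk>open S; smooth_on S g\<rbrakk> \<Longrightarrow> smooth_on S (\<lambda>x. g x ^ n)"
proof (induction n)
  case 0
  then show ?case by (simp add: smooth_on_def Ck_on_const)
next
  case (Suc n)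
  then show ?case by (simp add: smooth_on_mult)
qed

lemma smooth_on_inverse:
  fixes g :: "'e::real_normed_vector \<Rightarrow> real"
  shows "\<lbrakk>open S; \<And>x. x \<in> S \<Longrightarrow> g x \<noteq> 0; smooth_on S g\<rbrakk> \<Longrightarrow> smooth_on S (\<lambda>x. inverse (g x))"
  unfolding smooth_on_def using Ck_on_inverse by blast

lemma smooth_on_differentiable: "\<lbrakk>smooth_on S g; x \<in> S\<rbrakk> \<Longrightarrow> g differentiable (at x)"
  unfolding smooth_on_def by (metis Ck_on.simps(2))

section \<open>Isomorphic complexes\<close>

text \<open>\<open>T r\<close> carries cocycles onto cocycles and coboundaries onto coboundaries, so
  direct image maps cosets to cosets. Injectivity on the whole type detects
  \<open>D r \<omega> = 0\<close> wherever \<open>D r \<omega>\<close> lies, and makes direct image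
  injective on sets.\<close>

lemma cohomology_isomorphic:
  fixes T :: "nat \<Rightarrow> 'v::real_vector \<Rightarrow> 'w::real_vector"
  assumes lin: "\<And>r. linear (T r)" and inj: "\<And>r. inj (T r)"
    and img: "\<And>r. T r ` C r = C' r"
    and comm: "\<And>r \<omega>. \<omega> \<in> C r \<Longrightarrow> T (Suc r) (D r \<omega>) = D' r (T r \<omega>)"
  shows "real_space_isomorphic (cohomology C D r) (cohomology C' D' r)"
proof -
  let ?Z = "cocycles C D r" and ?Z' = "cocycles C' D' r"
  let ?B = "coboundaries C D r" and ?B' = "coboundaries C' D' r"
  have T0: "T s x = 0 \<longleftrightarrow> x = 0" for s x
    using linear_injective_0[OF lin] inj linear_0[OF lin] by metis
  have "D' r (T r \<omega>) = 0 \<longleftrightarrow> D r \<omega> = 0" if "\<omega> \<in> C r" for \<omega>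
    using comm[OF that] T0 by metis
  then have Z: "T r ` ?Z = ?Z'"
    unfolding cocycles_def img[symmetric] by auto
  have B: "T r ` ?B = ?B'"
  \<comment> \<open>Coboundaries in degree 0 are \<open>{0}\<close> by definition; in degree
    \<open>Suc s\<close> they come from degree \<open>s\<close>, where \<open>comm\<close>
    applies.\<close>
  proof (cases r)
    case 0
    then show ?thesis using T0 by simp
  next
    case (Suc s)
    then show ?thesis
      unfolding Suc coboundaries.simps img[symmetric] image_image
      by (intro image_cong) (auto simp: comm)
  qed
  have add: "T r ` (K + L) = T r ` K + T r ` L" for K L
    unfolding set_plus_image image_image
    by (auto simp: linear_add[OF lin] set_plus_def image_iff) metis+
  have scale: "T r ` ((*\<^sub>R) a ` K) = (*\<^sub>R) a ` T r ` K" for a K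
    by (simp add: image_image linear_scale[OF lin])
  have coset: "T r ` (z +o ?B) = T r z +o ?B'" for z
    unfolding B[symmetric] elt_set_plus_def
    by (auto simp: image_iff linear_add[OF lin]) (metis linear_add[OF lin])
  have "bij_betw (image (T r)) ((\<lambda>z. z +o ?B) ` ?Z) ((\<lambda>z. z +o ?B') ` ?Z')"
    unfolding bij_betw_def
  proof
    show "inj_on (image (T r)) ((\<lambda>z. z +o ?B) ` ?Z)"
      by (meson inj inj_image_eq_iff inj_onI)
    show "image (T r) ` (\<lambda>z. z +o ?B) ` ?Z = (\<lambda>z. z +o ?B') ` ?Z'"
      unfolding Z[symmetric] image_image coset ..
  qed
  \<comment> \<open>Coset operations are elementwise, so the direct image under a linear map
    respects them; the summand \<open>?B\<close> in \<open>rs_scale\<close> goes to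
    \<open>?B'\<close>.\<close>
  then show ?thesis
    unfolding real_space_isomorphic_def cohomology_def quotient_space_def
    by (intro exI[of _ "image (T r)"]) (simp add: add scale B)
qed

section \<open>Multiplication of forms by functions\<close>

lemma smooth_function_power:
  assumes "smooth_manifold X A" "smooth_function A f"
  shows "smooth_function A (\<lambda>p. f p ^ n)"
  unfolding smooth_function_def
proof
  fix c assume c: "c \<in> A"
  have "smooth_on (chart_image c) (\<lambda>x. (f \<circ> chart_inv c) x ^ n)"
    using assms(2) c
    by (intro smooth_on_power smooth_manifold.chart_image_open[OF assms(1) c])
      (auto simp: smooth_function_def o_def)
  then show "smooth_on (chart_image c) ((\<lambda>p. f p ^ n) \<circ> chart_inv c)"
    by (simp add: o_def)
qed

lemma chart_inv_in_topspace:
  assumes "smooth_manifold X A" "c \<in> A" "x \<in> chart_image c"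
  shows "chart_inv c x \<in> topspace X"
proof -
  have "chart_inv c x \<in> fst c"
    using assms(3) unfolding chart_image_def chart_inv_def by (rule inv_into_into)
  then show ?thesis
    using smooth_manifold.charts_cover[OF assms(1)] assms(2) by blast
qed

text \<open>Smoothness sees a function only through inverse charts, whose values lie in
  \<open>topspace X\<close>. This permits a free choice of values off the manifold.\<close>

lemma smooth_function_cong:
  assumes "smooth_manifold X A" "smooth_function A f" "\<And>p. p \<in> topspace X \<Longrightarrow> f p = g p"
  shows "smooth_function A g"
  unfolding smooth_function_def
proof
  fix c assume c: "c \<in> A"
  show "smooth_on (chart_image c) (g \<circ> chart_inv c)"
    by (rule smooth_on_cong_imp[of _ "f \<circ> chart_inv c"])
      (use assms(2,3) c smooth_manifold.chart_image_open[OF assms(1) c]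
        chart_inv_in_topspace[OF assms(1) c] in \<open>auto simp: smooth_function_def\<close>)
qed

lemma smooth_function_inverse:
  assumes "smooth_manifold X A" "smooth_function A f" "\<And>p. p \<in> topspace X \<Longrightarrow> f p \<noteq> 0"
  shows "smooth_function A (\<lambda>p. inverse (f p))"
  unfolding smooth_function_def
proof
  fix c assume c: "c \<in> A"
  have "smooth_on (chart_image c) (\<lambda>x. inverse ((f \<circ> chart_inv c) x))"
    using assms(2,3) c smooth_manifold.chart_image_open[OF assms(1) c]
      chart_inv_in_topspace[OF assms(1) c]
    by (intro smooth_on_inverse) (auto simp: smooth_function_def o_def)
  then show "smooth_on (chart_image c) ((\<lambda>p. inverse (f p)) \<circ> chart_inv c)"
    by (simp add: o_def)
qed

section \<open>Rescaling forms\<close>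

lemma inj_on_chart:
  assumes "smooth_manifold X A" "c \<in> A"
  shows "inj_on (snd c) (fst c)"
proof -
  have "fst c \<subseteq> topspace X"
    using smooth_manifold.charts_cover[OF assms(1)] assms(2) by blast
  then show ?thesis
    using smooth_manifold.chart_homeomorphic[OF assms]
    by (auto simp: homeomorphic_eq_everything_map Int_absorb1)
qed

text \<open>Coordinates related by a transition map describe the same point. Hence a scalar factor
  on the manifold is compatible with pullback along transitions.\<close>

lemma chart_inv_transition:
  assumes "smooth_manifold X A" "c \<in> A" "c' \<in> A" "x \<in> overlap c c'"
  shows "chart_inv c' (transition c c' x) = chart_inv c x"
  using assms(4) inj_on_chart[OF assms(1,2)] inj_on_chart[OF assms(1,3)]
  by (auto simp: overlap_def transition_def chart_inv_def)

lemma alternating_forms_scale: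
  assumes "a \<in> alternating_forms r"
  shows "(\<lambda>v. k * a v) \<in> alternating_forms r"
proof -
  have "linear (\<lambda>u. k * a (v(i := u)))" if "i < r" for v i
    using assms that linear_compose_scale_right[of "\<lambda>u. a (v(i := u))" k]
    by (simp add: alternating_forms_def)
  then show ?thesis
    using assms unfolding alternating_forms_def by simp
qed

lemma mult_form_in_forms:
  assumes "smooth_manifold X A" "smooth_function A g" "\<omega> \<in> forms A r"
  shows "mult_form g \<omega> \<in> forms A r"
proof -
  have "mult_form g \<omega> c x \<in> alternating_forms r" if "c \<in> A" "x \<in> chart_image c" for c x
    using alternating_forms_scale[of "\<omega> c x" r "g (chart_inv c x)"] assms(3) that
    by (simp add: forms_def mult_form_def[abs_def])
  moreover have "smooth_on (chart_image c) (\<lambda>x. mult_form g \<omega> c x v)" if "c \<in> A" for c v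
    using smooth_on_mult[of "chart_image c" "g \<circ> chart_inv c" "\<lambda>x. \<omega> c x v"]
      smooth_manifold.chart_image_open[OF assms(1) that] assms(2,3) that
    by (simp add: forms_def mult_form_def smooth_function_def)
  \<comment> \<open>\<open>mult_form\<close> stays folded at first, so that the two facts just shown
    match; unfolding it then settles extension by 0 and compatibility on overlaps.\<close>
  ultimately show ?thesis
    using assms(3) chart_inv_transition[OF assms(1)]
    by (simp add: forms_def) (simp add: mult_form_def)
qed

lemma mult_form_mult_form: "mult_form g (mult_form h \<omega>) = mult_form (\<lambda>p. g p * h p) \<omega>"
  by (simp add: mult_form_def fun_eq_iff)

lemma mult_form_eq_self: "(\<And>p. g p = 1) \<Longrightarrow> mult_form g \<omega> = \<omega>"
  by (simp add: mult_form_def fun_eq_iff)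

lemma linear_mult_form: "linear (mult_form g)"
  by (rule linearI)
    (simp_all add: mult_form_def fun_eq_iff plus_fun_def scaleR_fun_def algebra_simps)

section \<open>Comparison of the differentials in coordinates\<close>

lemma ext_deriv_function_form:
  assumes "smooth_manifold X A" "smooth_function A f" "c \<in> A" "x \<in> chart_image c"
  shows "ext_deriv A 0 (function_form A f) c x v = frechet_derivative (f \<circ> chart_inv c) (at x) (v 0)"
proof -
  \<comment> \<open>The extension by 0 is invisible to the derivative, since the chart image is an
    open neighbourhood of \<open>x\<close>.\<close>
  have "frechet_derivative (\<lambda>y. function_form A f c y (omit 0 v)) (at x)
      = frechet_derivative (f \<circ> chart_inv c) (at x)"
    using assms smooth_manifold.chart_image_open[OF assms(1)]
    by (intro frechet_derivative_cong_open[of "chart_image c"] smooth_on_differentiable)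
      (auto simp: smooth_function_def function_form_def)
  then show ?thesis
    using assms(3,4) by (simp add: ext_deriv_def)
qed

text \<open>Here \<open>g\<close> stands for 1/f on the manifold, which turns the negative powers of
  \<open>f\<close> into natural powers of \<open>g\<close>.\<close>

lemma mult_form_d_f_theta:
  assumes M: "smooth_manifold X A" and f: "smooth_function A f"
    and g: "smooth_function A g" and gf: "\<And>p. p \<in> topspace X \<Longrightarrow> g p * f p = 1"
    and \<omega>: "\<omega> \<in> forms A r"
  shows "mult_form (\<lambda>p. g p ^ Suc r) (d_f_theta A f \<theta> r \<omega>) =
    d_theta A \<theta> r (mult_form (\<lambda>p. g p ^ r) \<omega>)"
proof (intro ext)
  fix c :: "('a, 'b) chart" and x v
  show "mult_form (\<lambda>p. g p ^ Suc r) (d_f_theta A f \<theta> r \<omega>) c x v =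
    d_theta A \<theta> r (mult_form (\<lambda>p. g p ^ r) \<omega>) c x v"
  proof (cases "c \<in> A \<and> x \<in> chart_image c")
    \<comment> \<open>Both sides vanish here: \<omega> is extended by 0, and so is
      \<open>ext_deriv\<close> by definition.\<close>
    case False
    then have "\<omega> c x w = 0" for w
      using \<omega> unfolding forms_def by blast
    with False show ?thesis
      by (auto simp: d_theta_def d_f_theta_def d_f_def ext_deriv_def wedge1_def mult_form_def
          scaleR_fun_def)
  next
    case True
    then have c: "c \<in> A" and x: "x \<in> chart_image c"
      by auto
    let ?f = "f \<circ> chart_inv c" and ?g = "g \<circ> chart_inv c"
    let ?df = "frechet_derivative ?f (at x)" and ?dg = "frechet_derivative ?g (at x)"
    let ?d\<omega> = "\<lambda>i. frechet_derivative (\<lambda>y. \<omega> c y (omit i v)) (at x) (v i)"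
    have df: "?f differentiable (at x)" and dg: "?g differentiable (at x)"
      using f g c x by (auto simp: smooth_function_def intro: smooth_on_differentiable)
    have d\<omega>: "(\<lambda>y. \<omega> c y w) differentiable (at x)" for w
      using \<omega> c x smooth_on_differentiable by (fastforce simp: forms_def)
    have gf1: "?g y * ?f y = 1" if "y \<in> chart_image c" for y
      using gf chart_inv_in_topspace[OF M c that] by simp
    \<comment> \<open>The product of \<open>?g\<close> and \<open>?f\<close> is constantly 1 on the
      open chart image, so its derivative is 0.\<close>
    have dgf: "?g x * ?df u + ?dg u * ?f x = 0" for u
    proof -
      have "frechet_derivative (\<lambda>y. ?g y * ?f y) (at x) = frechet_derivative (\<lambda>_. 1) (at x)"
        using smooth_manifold.chart_image_open[OF M c] x gf1
        by (intro frechet_derivative_cong_open) auto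
      then show ?thesis
        by (metis frechet_derivative_mult_at[OF dg df] frechet_derivative_const)
    qed
    \<comment> \<open>Multiply \<open>dgf\<close> by \<open>?g x\<close> and cancel with
      \<open>gf1\<close>.\<close>
    have "?dg u = - (?g x ^ 2) * ?df u" for u
      using dgf[of u] gf1[OF x] by algebra
    \<comment> \<open>The power rule contains the truncated exponent \<open>r - 1\<close>: for
      \<open>r = 0\<close> both sides are 0, otherwise it combines with the square to
      \<open>Suc r\<close>.\<close>
    then have dgr: "frechet_derivative (\<lambda>y. ?g y ^ r) (at x) u = - (real r * ?g x ^ Suc r * ?df u)" for u
      unfolding frechet_derivative_power_at[OF dg] by (cases r) (simp_all add: power2_eq_square)
    have d: "frechet_derivative (\<lambda>y. mult_form (\<lambda>p. g p ^ r) \<omega> c y (omit i v)) (at x) (v i) =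
        ?g x ^ r * ?d\<omega> i - real r * ?g x ^ Suc r * ?df (v i) * \<omega> c x (omit i v)" for i
      using frechet_derivative_mult_at[OF differentiable_power[OF dg, of r] d\<omega>, of "omit i v" "v i"]
      unfolding dgr by (simp add: mult_form_def)
    \<comment> \<open>The exterior derivative and both wedge products are sums over the same indices
      with the same signs, so they merge into one sum to be compared termwise.\<close>
    have "mult_form (\<lambda>p. g p ^ Suc r) (d_f_theta A f \<theta> r \<omega>) c x v =
      (\<Sum>i\<le>r. ?g x ^ Suc r * ((-1) ^ i * (?f x * ?d\<omega> i - real r * ?df (v i) * \<omega> c x (omit i v)
        - ?f x * \<theta> c x (\<lambda>_. v i) * \<omega> c x (omit i v))))"
      unfolding d_f_theta_def d_f_def mult_form_def wedge1_def minus_apply scaleR_fun_def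
        ext_deriv_function_form[OF M f c x]
      by (simp add: ext_deriv_def True sum_distrib_left sum_subtractf[symmetric] algebra_simps)
    also have "\<dots> = (\<Sum>i\<le>r. (-1) ^ i * (?g x ^ r * ?d\<omega> i
        - real r * ?g x ^ Suc r * ?df (v i) * \<omega> c x (omit i v)
        - ?g x ^ r * \<theta> c x (\<lambda>_. v i) * \<omega> c x (omit i v)))"
      (is "(\<Sum>i\<le>r. ?L i) = (\<Sum>i\<le>r. ?R i)")
    proof (intro sum.cong refl)
      fix i
      have gr: "?g x ^ Suc r * ?f x = ?g x ^ r"
        using gf1[OF x] by (simp add: mult.assoc mult.commute mult.left_commute)
      show "?L i = ?R i"
        \<comment> \<open>Every \<open>?g x ^ r\<close> becomes \<open>?g x ^ Suc r * ?f x\<close>;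
          keeping \<open>power_Suc\<close> out leaves \<open>?g x ^ Suc r\<close> as an atom for the
          ring identity.\<close>
        unfolding gr[symmetric] by (simp add: algebra_simps del: power_Suc)
    qed
    also have "\<dots> = d_theta A \<theta> r (mult_form (\<lambda>p. g p ^ r) \<omega>) c x v"
      unfolding d_theta_def minus_apply wedge1_def ext_deriv_def
      by (simp add: True d sum_subtractf[symmetric] right_diff_distrib del: power_Suc)
        (simp add: mult_form_def algebra_simps)
    finally show ?thesis .
  qed
qed

theorem corollary3p1:
  fixes X :: "'a topology"
    and A :: "('a, 'e::real_normed_vector) chart set"
    and f :: "'a \<Rightarrow> real"
    and \<theta> :: "('a, 'e) form"
  assumes "smooth_manifold X A"
    and "smooth_function A f"
    and "closed_1_form A \<theta>"
    and "\<forall>p\<in>topspace X. f p \<noteq> 0"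
  shows "\<forall>r. real_space_isomorphic (f_theta_cohomology A f \<theta> r) (lichnerowicz_cohomology A \<theta> r)"
proof
  fix r
  \<comment> \<open>Off the manifold \<open>f\<close> may vanish. With the value 1 there, multiplication by \<open>g\<close> is injective on
    all functions of the type of forms, so it is not needed that coboundaries are forms.\<close>
  define g where "g p = (if p \<in> topspace X then inverse (f p) else 1)" for p
  have g0: "g p \<noteq> 0" for p
    using assms(4) by (simp add: g_def)
  have g: "smooth_function A g"
    using assms(4)
    by (intro smooth_function_cong[OF assms(1) smooth_function_inverse[OF assms(1,2)]])
      (auto simp: g_def)
  have gf: "g p * f p = 1" if "p \<in> topspace X" for p
    using assms(4) that by (simp add: g_def)
  let ?T = "\<lambda>r. mult_form (\<lambda>p. g p ^ r) :: ('a, 'e) form \<Rightarrow> _"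
  let ?T' = "\<lambda>r. mult_form (\<lambda>p. inverse (g p) ^ r) :: ('a, 'e) form \<Rightarrow> _"
  \<comment> \<open>Because \<open>g\<close> vanishes nowhere, the two maps are mutually inverse on
    all functions of the type of forms, giving injectivity of \<open>?T r\<close>; by
    \<open>T\<close> they also preserve forms, giving surjectivity.\<close>
  have T'T: "?T' r (?T r \<omega>) = \<omega>" and TT': "?T r (?T' r \<omega>) = \<omega>" for r \<omega>
    by (simp_all add: mult_form_mult_form mult_form_eq_self g0 flip: power_mult_distrib)
  have T: "?T r \<omega> \<in> forms A r" "?T' r \<omega> \<in> forms A r" if "\<omega> \<in> forms A r" for r \<omega>
    using that g0
    by (intro mult_form_in_forms[OF assms(1)] smooth_function_power[OF assms(1)]
        smooth_function_inverse[OF assms(1)] g; simp)+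
  show "real_space_isomorphic (f_theta_cohomology A f \<theta> r) (lichnerowicz_cohomology A \<theta> r)"
    unfolding f_theta_cohomology_def lichnerowicz_cohomology_def
  proof (rule cohomology_isomorphic[of ?T])
    show "inj (?T r)" for r
      by (metis T'T injI)
    show "?T r ` forms A r = forms A r" for r
    proof
      show "?T r ` forms A r \<subseteq> forms A r"
        using T(1) by blast
      show "forms A r \<subseteq> ?T r ` forms A r"
      proof
        fix \<omega> assume "\<omega> \<in> forms A r"
        then show "\<omega> \<in> ?T r ` forms A r"
          by (intro image_eqI[where x = "?T' r \<omega>"] T(2)) (simp_all only: TT')
      qed
    qed
  qed (use linear_mult_form mult_form_d_f_theta[OF assms(1,2) g gf] in blast)+
qed

end
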